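(* Let $m,n\ge 1$ and consider the system $$\dot r=P(t,r,\theta),\qquad \dot\theta=A(r)+Q(t,r,\theta),\qquad r\in\mathbf R^m_+,\ \theta\in\mathbf T^n,$$ where $A\in C^1(\mathbf R^m_+,\mathbf R^n)$ has all components $A_k(r)>0$, and $P\in C^{0,1,1}_{t,r,\theta}(\mathbf R\times\mathbf R^m_+\times\mathbf T^n,\mathbf R^m)$, $Q\in C^{0,1,1}_{t,r,\theta}(\mathbf R\times\mathbf R^m_+\times\mathbf T^n,\mathbf R^n)$. Let $(r(t),\theta(t))$ be a solution of this system, defined on some half-line $[t_0,+\infty)$, which is bounded with respect to the $r$-coordinates (i.e. $\sup_{t\ge t_0}\|r(t)\|<\infty$), and suppose that for some real $p>1$ $$t^p\|P(t,r(t),\theta(t))\|\to0\quad\text{as } t\to+\infty.$$ Then there exists $r^*\in\mathbf R^m_+$ such that $\lim_{t\to+\infty}r(t)=r^*$.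
   Context: $\mathbf R_+=[0,+\infty)$, $\mathbf R^m_+=[0,+\infty)^m$, and $\mathbf T^n$ is the $n$-dimensional torus. Writing $\theta\in\mathbf T^n$ means that $\theta\in\mathbf R^n$ and the functions $P,Q$ are periodic (with constant period) in each component of $\theta$. $C^{0,1,1}_{t,r,\theta}$ denotes functions continuous in all variables and continuously differentiable with respect to $r$ and $\theta$. $\|\cdot\|$ is the Euclidean norm. *)

theory Defs
  imports "HOL-Analysis.Analysis"
begin

definition orthant :: "(real ^ 'm) set" where
  "orthant = {r. \<forall>i. 0 \<le> r $ i}"

text \<open>Derivatives at boundary points are taken within the set; for a convex set with nonempty
  interior, such as the orthant, they are unique there.\<close>

definition C1_on :: "'a::real_normed_vector set \<Rightarrow> ('a \<Rightarrow> 'b::real_normed_vector) \<Rightarrow> bool" where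
  "C1_on S f \<longleftrightarrow>
     (\<exists>f' :: 'a \<Rightarrow> 'a \<Rightarrow>\<^sub>L 'b.
        (\<forall>x\<in>S. (f has_derivative blinfun_apply (f' x)) (at x within S)) \<and>
        continuous_on S f')"

text \<open>The class \<open>C^{0,1,1}\<close> in the variables \<open>t\<close>, \<open>r\<close>, \<open>\<theta>\<close>: continuous in all variables, with
  partial derivatives in \<open>r\<close> and in \<open>\<theta>\<close> that are continuous in all variables.\<close>

definition C011 :: "(real \<Rightarrow> real ^ 'm \<Rightarrow> real ^ 'n \<Rightarrow> 'b::real_normed_vector) \<Rightarrow> bool" where
  "C011 f \<longleftrightarrow>
     continuous_on (UNIV \<times> orthant \<times> UNIV) (\<lambda>(t, r, \<theta>). f t r \<theta>) \<and>
     (\<exists>Dr :: real \<Rightarrow> real ^ 'm \<Rightarrow> real ^ 'n \<Rightarrow> (real ^ 'm) \<Rightarrow>\<^sub>L 'b.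
        (\<forall>t. \<forall>r\<in>orthant. \<forall>\<theta>.
           ((\<lambda>r. f t r \<theta>) has_derivative blinfun_apply (Dr t r \<theta>)) (at r within orthant)) \<and>
        continuous_on (UNIV \<times> orthant \<times> UNIV) (\<lambda>(t, r, \<theta>). Dr t r \<theta>)) \<and>
     (\<exists>D\<theta> :: real \<Rightarrow> real ^ 'm \<Rightarrow> real ^ 'n \<Rightarrow> (real ^ 'n) \<Rightarrow>\<^sub>L 'b.
        (\<forall>t. \<forall>r\<in>orthant. \<forall>\<theta>.
           ((\<lambda>\<theta>. f t r \<theta>) has_derivative blinfun_apply (D\<theta> t r \<theta>)) (at \<theta>)) \<and>
        continuous_on (UNIV \<times> orthant \<times> UNIV) (\<lambda>(t, r, \<theta>). D\<theta> t r \<theta>))"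

text \<open>Functions of \<open>\<theta>\<close> on the torus are functions on the whole space that are periodic in each
  component \<open>\<theta>\<^sub>k\<close>, with constant period \<open>\<omega>\<^sub>k\<close>.\<close>

definition torus_periodic ::
    "real ^ 'n \<Rightarrow> (real \<Rightarrow> real ^ 'm \<Rightarrow> real ^ 'n \<Rightarrow> 'b) \<Rightarrow> bool" where
  "torus_periodic \<omega> f \<longleftrightarrow>
     (\<forall>t. \<forall>r\<in>orthant. \<forall>\<theta> k. f t r (\<theta> + axis k (\<omega> $ k)) = f t r \<theta>)"

definition is_solution ::
    "(real ^ 'm \<Rightarrow> real ^ 'n) \<Rightarrow>
     (real \<Rightarrow> real ^ 'm \<Rightarrow> real ^ 'n \<Rightarrow> real ^ 'm) \<Rightarrow>
     (real \<Rightarrow> real ^ 'm \<Rightarrow> real ^ 'n \<Rightarrow> real ^ 'n) \<Rightarrow>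
     real \<Rightarrow> (real \<Rightarrow> real ^ 'm) \<Rightarrow> (real \<Rightarrow> real ^ 'n) \<Rightarrow> bool" where
  "is_solution A P Q t0 r \<theta> \<longleftrightarrow>
     (\<forall>t\<ge>t0. r t \<in> orthant \<and>
        (r has_vector_derivative P t (r t) (\<theta> t)) (at t within {t0..}) \<and>
        (\<theta> has_vector_derivative A (r t) + Q t (r t) (\<theta> t)) (at t within {t0..}))"

end

theory Submission
  imports Defs
begin

text \<open>Since \<open>p > 1\<close>, eventually \<open>\<parallel>r'(t)\<parallel> \<le> t powr - p\<close>, which is the derivative of a function with a
  finite limit at infinity; hence \<open>r\<close> satisfies the Cauchy criterion. The orthant is closed, so it
  contains the limit.\<close>

lemma convergent_at_top_if_derivative_dominated:
  fixes f :: "real \<Rightarrow> 'a::banach" and \<phi> :: "real \<Rightarrow> real"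
  assumes f: "\<And>t. t \<ge> a \<Longrightarrow> (f has_vector_derivative f' t) (at t within {a..})"
    and \<phi>: "\<And>t. t \<ge> a \<Longrightarrow> (\<phi> has_real_derivative \<phi>' t) (at t within {a..})"
    and le: "\<And>t. t \<ge> a \<Longrightarrow> norm (f' t) \<le> \<phi>' t"
    and lim: "(\<phi> \<longlongrightarrow> L) at_top"
  shows "\<exists>l. (f \<longlongrightarrow> l) at_top"
proof -
  \<comment> \<open>The mean value inequality replaces integration here: it bounds increments of
    \<open>f\<close> by those of \<open>\<phi>\<close> without assuming that \<open>f'\<close> is
    integrable.\<close>
  have bound: "norm (f t - f s) \<le> \<phi> t - \<phi> s" if "a \<le> s" "s < t" for s t
  proof (rule differentiable_bound_general[OF that(2)])
    show "continuous_on {s..t} f"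
      by (rule continuous_on_vector_derivative,
          rule has_vector_derivative_within_subset[OF f]) (use that in auto)
    show "continuous_on {s..t} \<phi>"
      by (rule DERIV_continuous_on, rule DERIV_subset[OF \<phi>]) (use that in auto)
    fix x assume x: "s < x" "x < t"
    \<comment> \<open>Since \<open>a \<le> s < x\<close>, the point \<open>x\<close> lies in the
      interior of the half-line, so the derivatives within it are the two-sided ones that the mean
      value inequality asks for.\<close>
    then have at: "at x within {a..} = at x"
      by (intro at_within_interior) (use that in simp)
    show "(f has_vector_derivative f' x) (at x)"
      using f[of x] x that by (simp add: at)
    show "(\<phi> has_vector_derivative \<phi>' x) (at x)"
      using \<phi>[of x] x that by (simp add: at has_real_derivative_iff_has_vector_derivative)
    show "norm (f' x) \<le> \<phi>' x"
      using le x that by simp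
  qed
  \<comment> \<open>The symmetric form of \<open>bound\<close>, which lets the Cauchy property of
    \<open>\<phi>\<close> at infinity pass to \<open>f\<close>.\<close>
  have dist_le: "dist (f s) (f t) \<le> dist (\<phi> s) (\<phi> t)" if "a \<le> s" "a \<le> t" for s t
    using bound[of s t] bound[of t s] that
    by (cases s t rule: linorder_cases) (auto simp: dist_norm norm_minus_commute)
  have "cauchy_filter (filtermap f at_top)"
    unfolding cauchy_filter_metric_filtermap
  proof (intro allI impI)
    fix e :: real assume "e > 0"
    then have "\<forall>\<^sub>F t in at_top. dist (\<phi> t) L < e / 2"
      by (intro tendstoD[OF lim]) simp
    moreover have "dist (f s) (f t) < e"
      if "a \<le> s" "dist (\<phi> s) L < e / 2" "a \<le> t" "dist (\<phi> t) L < e / 2" for s t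
      using dist_le[of s t] dist_triangle_half_l[of "\<phi> s" L e "\<phi> t"] that by simp
    ultimately show "\<exists>R. eventually R at_top \<and> (\<forall>s t. R s \<and> R t \<longrightarrow> dist (f s) (f t) < e)"
      by (intro exI[of _ "\<lambda>t. a \<le> t \<and> dist (\<phi> t) L < e / 2"])
        (auto intro: eventually_conj eventually_ge_at_top)
  qed
  moreover have "complete (UNIV :: 'a set)"
    by (rule complete_UNIV)
  \<comment> \<open>Completeness in filter form: a proper Cauchy filter converges. The image filter
    is proper because \<open>at_top\<close> on the reals is.\<close>
  ultimately obtain l where "filtermap f at_top \<le> nhds l"
    unfolding complete_uniform
    by (metis filtermap_bot_iff principal_le_iff top_greatest top_eq_principal_UNIV
        trivial_limit_at_top_linorder)
  then show ?thesis
    unfolding filterlim_def by blast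
qed

text \<open>Convergence at infinity depends only on late times, so the domination lemma can be
  applied on a half-line where a power bound on \<open>f'\<close> already holds.\<close>

lemma convergent_at_top_if_derivative_decays:
  fixes f :: "real \<Rightarrow> 'a::banach"
  assumes f: "\<And>t. t \<ge> a \<Longrightarrow> (f has_vector_derivative f' t) (at t within {a..})"
    and "1 < p"
    and lim: "((\<lambda>t. t powr p * norm (f' t)) \<longlongrightarrow> 0) at_top"
  shows "\<exists>l. (f \<longlongrightarrow> l) at_top"
proof -
  have "\<forall>\<^sub>F t in at_top. t powr p * norm (f' t) < 1"
    using order_tendstoD(2)[OF lim] by simp
  then obtain b where b: "\<And>t. t \<ge> b \<Longrightarrow> t powr p * norm (f' t) < 1"
    unfolding eventually_at_top_linorder by blast
  \<comment> \<open>Beyond \<open>a\<close> the derivative of \<open>f\<close> is known, beyond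
    \<open>b\<close> the bound holds, and from 1 on \<open>t\<close> is positive, so
    \<open>powr\<close> has its usual derivative and \<open>t powr p\<close> can be divided
    out.\<close>
  define c where "c = Max {a, b, 1}"
  have c: "a \<le> c" "b \<le> c" "1 \<le> c"
    unfolding c_def by simp_all
  show ?thesis
  proof (rule convergent_at_top_if_derivative_dominated)
    fix t assume t: "c \<le> t"
    show "(f has_vector_derivative f' t) (at t within {c..})"
      by (rule has_vector_derivative_within_subset[OF f]) (use t c in auto)
    \<comment> \<open>This antiderivative is negative and increases to 0, because the exponent
      \<open>1 - p\<close> is negative.\<close>
    show "((\<lambda>t. t powr (1 - p) / (1 - p)) has_real_derivative t powr - p) (at t within {c..})"
      using t c \<open>1 < p\<close> by (auto intro!: derivative_eq_intros)
    show "norm (f' t) \<le> t powr - p"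
      using b[of t] t c by (simp add: powr_minus field_simps)
  next
    show "((\<lambda>t. t powr (1 - p) / (1 - p)) \<longlongrightarrow> 0) at_top"
      using \<open>1 < p\<close> by (auto intro!: tendsto_divide_zero tendsto_neg_powr filterlim_ident)
  qed
qed

lemma closed_orthant: "closed (orthant :: (real ^ 'm) set)"
  unfolding orthant_def by (intro closed_Collect_all closed_Collect_le continuous_intros)

theorem theorem4p3:
  fixes A :: "real ^ 'm \<Rightarrow> real ^ 'n"
    and P :: "real \<Rightarrow> real ^ 'm \<Rightarrow> real ^ 'n \<Rightarrow> real ^ 'm"
    and Q :: "real \<Rightarrow> real ^ 'm \<Rightarrow> real ^ 'n \<Rightarrow> real ^ 'n"
    and \<omega> :: "real ^ 'n"
    and r :: "real \<Rightarrow> real ^ 'm"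
    and \<theta> :: "real \<Rightarrow> real ^ 'n"
    and t0 p :: real
  assumes "\<And>k. 0 < \<omega> $ k"
    and "C1_on orthant A"
    and "\<And>x k. x \<in> orthant \<Longrightarrow> 0 < A x $ k"
    and "C011 P" and "torus_periodic \<omega> P"
    and "C011 Q" and "torus_periodic \<omega> Q"
    and "is_solution A P Q t0 r \<theta>"
    and "bounded (r ` {t0..})"
    and "1 < p"
    and "((\<lambda>t. t powr p * norm (P t (r t) (\<theta> t))) \<longlongrightarrow> 0) at_top"
  shows "\<exists>r_star \<in> orthant. (r \<longlongrightarrow> r_star) at_top"
proof -
  have sol: "r t \<in> orthant" "(r has_vector_derivative P t (r t) (\<theta> t)) (at t within {t0..})"
    if "t \<ge> t0" for t
    using assms(8) that unfolding is_solution_def by auto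
  \<comment> \<open>Along the solution \<open>f' t\<close> is \<open>P t (r t) (\<theta> t)\<close>,
    so the assumed decay of \<open>P\<close> is exactly the decay of the derivative of
    \<open>r\<close>.\<close>
  obtain l where l: "(r \<longlongrightarrow> l) at_top"
    using convergent_at_top_if_derivative_decays[OF sol(2) assms(10,11)] by blast
  have "\<forall>\<^sub>F t in at_top. r t \<in> orthant"
    using eventually_ge_at_top[of t0] by eventually_elim (rule sol(1))
  then have "l \<in> orthant"
    by (rule Lim_in_closed_set[OF closed_orthant _ _ l]) simp
  with l show ?thesis
    by blast
qed

end
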